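(* Let $\Sigma^-_{xx}\in\mathbb{R}^{N\times N}$ be symmetric positive semidefinite, $C\in\mathbb{R}^{m\times N}$, $\mathcal{R}^{\text{sensor}}\in\mathbb{R}^{m\times m}$ a diagonal matrix with positive diagonal entries, $M_u\in\mathbb{R}^{r\times N}$ and $\gamma_u\in\mathbb{R}$. Consider the optimization problem over symmetric $\mathcal{S}\in\mathbb{R}^{m\times m}$, symmetric $Q_u\in\mathbb{R}^{r\times r}$ and arbitrary $K\in\mathbb{R}^{N\times m}$: $$\min_{\mathcal{S}\ge 0,\;Q_u\ge 0,\;K}\ \operatorname{tr}(\mathcal{S})$$ subject to $$\begin{bmatrix} Q_u & M_u(I-KC)\sqrt{\Sigma^-_{xx}} & M_uK & M_uK\\ \sqrt{\Sigma^-_{xx}}(I-KC)^TM_u^T & I & 0 & 0\\ K^TM_u^T & 0 & (\mathcal{R}^{\text{sensor}})^{-1} & 0\\ K^TM_u^T & 0 & 0 & \mathcal{S}\end{bmatrix}\ge 0,\qquad \operatorname{tr}(Q_u)\le\gamma_u .$$ Then the maximum synthetic noise satisfying the utility constraint $\operatorname{tr}(\Sigma^+_{x_ux_u})\le\gamma_u$ is given by the solution of this problem. That is, if $(\mathcal{S},Q_u,K)$ is an optimal solution, then the synthetic noise with precision $\mathcal{S}$ (i.e. with covariance $\mathcal{R}^{\text{data}}=\mathcal{S}^{-1}$) satisfies $\operatorname{tr}(\Sigma^+_{x_ux_u})\le\gamma_u$, and $\mathcal{S}$ has the smallest trace among all precision matrices $\mathcal{S}'\ge0$ of synthetic noise for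 which $\operatorname{tr}(\Sigma^+_{x_ux_u})\le\gamma_u$.
   Context: For symmetric matrices, $A\ge B$ means $A-B$ is positive semidefinite; $\sqrt{\cdot}$ is the symmetric positive semidefinite square root. A fixed time step of an Ensemble/Unscented Kalman filter with linear measurement model $Y=CX+V$ is considered and the time index is suppressed. $\Sigma^-_{xx}$ is the prior state covariance; under the linear measurement model $\Sigma^-_{xy}=\Sigma^-_{xx}C^T$ and $\Sigma^-_{yy}=C\Sigma^-_{xx}C^T$. The covariance of $V$ is $\mathcal{R}^{\text{sensor}}+\mathcal{R}^{\text{data}}$, where $\mathcal{R}^{\text{sensor}}$ is the known sensor noise covariance and $\mathcal{R}^{\text{data}}$ (symmetric, positive semidefinite) is the covariance of added synthetic noise. The posterior error covariance of the utility variable $X_u=M_uX$ is $$\Sigma^+_{x_ux_u}:=M_u\Sigma^-_{xx}M_u^T-M_u\Sigma^-_{xx}C^T\left(C\Sigma^-_{xx}C^T+\mathcal{R}^{\text{sensor}}+\mathcal{R}^{\text{data}}\right)^{-1}C\Sigma^-_{xx}M_u^T .$$ The precision of the synthetic noise is $\mathcal{S}=(\mathcal{R}^{\text{data}})^{-1}$; "maximum noise" means minimum trace of the precision. A singular precision $\mathcal{S}\ge0$ is allowed and represents infinite noise in the directions of its kernel: $\Sigma^+_{x_ux_u}$ for such $\mathcal{S}$ is the limit, as $\varepsilon\downarrow0$, of its value for $\mathcal{R}^{\text{data}}=(\mathcal{S}+\varepsilon I)^{-1}$. *)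

theory Defs
  imports "HOL-Analysis.Analysis"
begin

definition psd :: "real^'n^'n \<Rightarrow> bool" where
  "psd A \<longleftrightarrow> transpose A = A \<and> (\<forall>x. 0 \<le> x \<bullet> (A *v x))"

text \<open>Meaningful only for positive semidefinite arguments, where the root exists and is unique.\<close>

definition psd_sqrt :: "real^'n^'n \<Rightarrow> real^'n^'n" where
  "psd_sqrt A = (THE B. psd B \<and> B ** B = A)"

text \<open>Block matrices are indexed by sum types: \<open>hcat A B\<close> is the block row [A B], and
  \<open>vcat A B\<close> puts A above B.\<close>

definition hcat :: "'a^'m^'k \<Rightarrow> 'a^'n^'k \<Rightarrow> 'a^('m + 'n)^'k" (infixr "|||" 62) where
  "A ||| B = (\<chi> i j. case j of Inl a \<Rightarrow> A $ i $ a | Inr b \<Rightarrow> B $ i $ b)"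

definition vcat :: "'a^'k^'m \<Rightarrow> 'a^'k^'n \<Rightarrow> 'a^'k^('m + 'n)" (infixr "===" 61) where
  "A === B = (\<chi> i. case i of Inl a \<Rightarrow> A $ a | Inr b \<Rightarrow> B $ b)"

text \<open>Posterior covariance of the utility variable: prior state covariance \<open>P\<close>, measurement
  matrix \<open>C\<close>, sensor noise covariance \<open>Rs\<close>, utility matrix \<open>Mu\<close>, synthetic noise
  covariance \<open>Rd\<close>.\<close>

definition posterior_cov ::
  "real^'n^'n \<Rightarrow> real^'n^'m \<Rightarrow> real^'m^'m \<Rightarrow> real^'n^'r \<Rightarrow> real^'m^'m \<Rightarrow> real^'r^'r" where
  "posterior_cov P C Rs Mu Rd =
     Mu ** P ** transpose Mu
     - Mu ** P ** transpose C ** matrix_inv (C ** P ** transpose C + Rs + Rd)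
         ** C ** P ** transpose Mu"

text \<open>The same covariance as a function of the precision \<open>S\<close> of the synthetic noise. A singular
  precision means infinite noise along its kernel; the covariance is then the limit over the
  regularised precisions \<open>S + \<epsilon> I\<close>. For positive semidefinite \<open>S\<close> this limit exists (the
  covariance increases as \<open>\<epsilon>\<close> decreases and is bounded above by the prior term).\<close>

definition posterior_cov_of_precision ::
  "real^'n^'n \<Rightarrow> real^'n^'m \<Rightarrow> real^'m^'m \<Rightarrow> real^'n^'r \<Rightarrow> real^'m^'m \<Rightarrow> real^'r^'r" where
  "posterior_cov_of_precision P C Rs Mu S =
     (if invertible S then posterior_cov P C Rs Mu (matrix_inv S)
      else Lim (at_right 0) (\<lambda>\<epsilon>::real. posterior_cov P C Rs Mu (matrix_inv (S + \<epsilon> *\<^sub>R mat 1))))"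

definition utility_lmi ::
  "real^'n^'n \<Rightarrow> real^'n^'m \<Rightarrow> real^'m^'m \<Rightarrow> real^'n^'r \<Rightarrow>
   real^'m^'m \<Rightarrow> real^'r^'r \<Rightarrow> real^'m^'n \<Rightarrow> real^('r + 'n + 'm + 'm)^('r + 'n + 'm + 'm)" where
  "utility_lmi P C Rs Mu S Q K =
     (Q ||| Mu ** (mat 1 - K ** C) ** psd_sqrt P ||| Mu ** K ||| Mu ** K)
     === (psd_sqrt P ** transpose (mat 1 - K ** C) ** transpose Mu ||| mat 1 ||| 0 ||| 0)
     === (transpose K ** transpose Mu ||| 0 ||| matrix_inv Rs ||| 0)
     === (transpose K ** transpose Mu ||| 0 ||| 0 ||| S)"

definition feasible ::
  "real^'n^'n \<Rightarrow> real^'n^'m \<Rightarrow> real^'m^'m \<Rightarrow> real^'n^'r \<Rightarrow> real \<Rightarrow>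
   (real^'m^'m) \<times> (real^'r^'r) \<times> (real^'m^'n) \<Rightarrow> bool" where
  "feasible P C Rs Mu \<gamma> = (\<lambda>(S, Q, K).
     psd S \<and> psd Q \<and> psd (utility_lmi P C Rs Mu S Q K) \<and> trace Q \<le> \<gamma>)"

end

theory Submission
  imports Defs
begin

text \<open>
  Put \<open>A = C P C\<^sup>T + Rs\<close> and \<open>L = \<surd>P\<close>. For positive semidefinite \<open>S\<close> the matrix
  \<open>S (I + A S)\<^bsup>-1\<^esup>\<close> exists, depends continuously on \<open>S\<close> and equals \<open>(A + S\<^bsup>-1\<^esup>)\<^bsup>-1\<^esup>\<close> for invertible
  \<open>S\<close>; hence it yields the posterior covariance for singular precisions as well, without a limit.
  For a vector \<open>u\<close> let \<open>f = L Mu\<^sup>T u\<close> and \<open>y = (I + A S)\<^bsup>-1\<^esup> C L f\<close>, \<open>x = S y\<close>. Evaluating the block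
  matrix at \<open>(u, L C\<^sup>T x - f, - Rs x, - y)\<close> eliminates the gain and shows that \<open>Q\<close> dominates the
  posterior covariance for every feasible point. Conversely, with \<open>Q\<close> the posterior covariance and
  \<open>K\<close> the Kalman gain \<open>P C\<^sup>T S (I + A S)\<^bsup>-1\<^esup>\<close> the quadratic form of the block matrix is a sum of
  three squares. So the constraints on \<open>S\<close> in both problems coincide.
\<close>

section \<open>Transposes, traces and inverses of real matrices\<close>

lemma inner_transpose_left: "(transpose A *v x) \<bullet> y = x \<bullet> (A *v y)" for A :: "real^'n^'m"
  by (simp add: dot_lmul_matrix)

lemma transpose_eq_iff_inner:
  fixes A :: "real^'n^'n"
  shows "transpose A = A \<longleftrightarrow> (\<forall>x y. (A *v x) \<bullet> y = x \<bullet> (A *v y))" (is "_ = ?R")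
proof
  assume "transpose A = A"
  then show ?R by (metis inner_transpose_left)
next
  assume R: ?R
  have "transpose A *v x = A *v x" for x
    by (rule vector_eq_rdot[THEN iffD1]) (use R in \<open>simp only: inner_transpose_left, simp\<close>)
  then show "transpose A = A" by (subst matrix_eq) blast
qed

lemma trace_eq_sum_inner: "trace A = (\<Sum>i\<in>UNIV. axis i 1 \<bullet> (A *v axis i 1))" for A :: "real^'n^'n"
  by (simp add: trace_def matrix_vector_mult_basis inner_axis' column_def)

lemma trace_mono:
  fixes A B :: "real^'n^'n"
  assumes "\<And>x. x \<bullet> (A *v x) \<le> x \<bullet> (B *v x)"
  shows "trace A \<le> trace B"
  unfolding trace_eq_sum_inner by (intro sum_mono assms)

lemma
  fixes A :: "'a::semiring_1^'n^'n"
  assumes "invertible A"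
  shows matrix_inv_mult_left: "matrix_inv A ** A = mat 1"
    and matrix_inv_mult_right: "A ** matrix_inv A = mat 1"
  using someI_ex[OF assms[unfolded invertible_def]] by (auto simp: matrix_inv_def)

lemma matrix_inv_unique:
  fixes A :: "'a::field^'n^'n"
  assumes "A ** B = mat 1"
  shows "matrix_inv A = B"
proof -
  have "invertible A" using assms invertible_right_inverse by blast
  then have "matrix_inv A ** (A ** B) = B"
    by (simp add: matrix_mul_assoc matrix_inv_mult_left)
  then show ?thesis by (simp add: assms)
qed

lemma invertibleI_kernel:
  fixes A :: "'a::field^'n^'n"
  assumes "\<And>x. A *v x = 0 \<Longrightarrow> x = 0"
  shows "invertible A"
  using assms by (auto simp: invertible_left_inverse matrix_left_invertible_ker)

lemma tendsto_det:
  fixes f :: "'b \<Rightarrow> real^'n^'n"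
  assumes "(f \<longlongrightarrow> A) F"
  shows "((\<lambda>x. det (f x)) \<longlongrightarrow> det A) F"
  unfolding det_def by (intro tendsto_intros assms)

text \<open>By Cramer's rule the entries of the inverse are quotients of determinants, hence
  continuous where the determinant is nonzero. Since \<open>det A\<close> is nonzero, so is
  \<open>det (f x)\<close> eventually, and the quotient formula \<open>G\<close> then agrees with
  \<open>matrix_inv\<close>.\<close>

lemma tendsto_matrix_inv:
  fixes f :: "'b \<Rightarrow> real^'n^'n"
  assumes f: "(f \<longlongrightarrow> A) F" and A: "invertible A"
  shows "((\<lambda>x. matrix_inv (f x)) \<longlongrightarrow> matrix_inv A) F"
proof -
  define G where "G M = (\<chi> i j. det (\<chi> a b. if b = i then axis j 1 $ a else M $ a $ b) / det M)"
    for M :: "real^'n^'n"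
  have G: "matrix_inv M = G M" if "det M \<noteq> 0" for M
  proof -
    have "M *v column j (matrix_inv M) = axis j 1" for j
      using matrix_inv_mult_right[of M] that
      by (metis invertible_det_nz matrix_vector_mul_assoc matrix_vector_mul_lid matrix_vector_mult_basis)
    then have "column j (matrix_inv M) = (\<chi> k. det (\<chi> a b. if b = k then axis j 1 $ a else M $ a $ b) / det M)" for j
      using cramer[OF that] by blast
    then show ?thesis by (simp add: vec_eq_iff G_def column_def)
  qed
  have dA: "det A \<noteq> 0" using A by (simp add: invertible_det_nz)
  have "\<forall>\<^sub>F x in F. det (f x) \<noteq> 0"
    using tendsto_imp_eventually_ne[OF tendsto_det[OF f] dA] .
  then have ev: "\<forall>\<^sub>F x in F. G (f x) = matrix_inv (f x)"
    by eventually_elim (simp add: G)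
  have "((\<lambda>x. if b = i then axis j 1 $ a else f x $ a $ b) \<longlongrightarrow>
      (if b = i then axis j 1 $ a else A $ a $ b)) F" for i j a b
    by (cases "b = i") (auto intro!: tendsto_intros f)
  then have "((\<lambda>x. G (f x)) \<longlongrightarrow> G A) F"
    unfolding G_def by (intro tendsto_intros tendsto_det f dA)
  then show ?thesis
    using G[OF dA] by (simp add: tendsto_cong[OF ev])
qed

section \<open>Square roots of positive semidefinite matrices\<close>

text \<open>Spectral theorem by induction on the dimension: the form \<open>x \<bullet> f x\<close>
  attains its maximum on the compact unit sphere of \<open>V\<close>, a maximiser \<open>v\<close>
  is an eigenvector, and the orthogonal complement of \<open>v\<close> in \<open>V\<close> is again
  invariant. The induction passes to that complement, hence the formulation for invariant
  subspaces.\<close>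

lemma selfadjoint_orthonormal_eigenbasis:
  fixes f :: "'a::euclidean_space \<Rightarrow> 'a"
  assumes lin: "linear f" and sym: "\<And>x y. f x \<bullet> y = x \<bullet> f y"
    and V: "subspace V" "f ` V \<subseteq> V"
  shows "\<exists>B. finite B \<and> B \<subseteq> V \<and> V \<subseteq> span B \<and> pairwise orthogonal B \<and>
    (\<forall>b\<in>B. norm b = 1 \<and> f b = (b \<bullet> f b) *\<^sub>R b)"
  using V
proof (induction "dim V" arbitrary: V rule: less_induct)
  case less
  show ?case
  proof (cases "V = {0}")
    case True
    then show ?thesis by (intro exI[of _ "{}"]) auto
  next
    case False
    interpret f: linear f by (rule lin)
    define U where "U = V \<inter> sphere 0 1"
    have contf: "continuous_on U f"
      using lin linear_continuous_on linear_conv_bounded_linear by blast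
    obtain x0 where "x0 \<in> V" "x0 \<noteq> 0" using False less.prems(1) subspace_0 by blast
    then have "x0 /\<^sub>R norm x0 \<in> U" using less.prems(1) by (auto simp: U_def subspace_scale)
    moreover have "compact U"
      unfolding U_def by (rule closed_Int_compact) (auto simp: closed_subspace less.prems)
    ultimately obtain v where v: "v \<in> U" and vmax: "\<And>x. x \<in> U \<Longrightarrow> x \<bullet> f x \<le> v \<bullet> f v"
      using continuous_attains_sup[of U "\<lambda>x. x \<bullet> f x"] contf
      by (force intro: continuous_intros)
    define l where "l = v \<bullet> f v"
    have vV: "v \<in> V" and nv: "norm v = 1" using v by (auto simp: U_def)
    have max: "x \<bullet> f x \<le> l * (x \<bullet> x)" if "x \<in> V" for x
    proof (cases "x = 0")
      case True then show ?thesis by (simp add: f.zero)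
    next
      case False
      have "x /\<^sub>R norm x \<in> U" using that False less.prems(1) by (auto simp: U_def subspace_scale)
      from vmax[OF this] have "(x \<bullet> f x) / (norm x)\<^sup>2 \<le> l"
        by (simp add: l_def f.scale power2_eq_square divide_inverse mult_ac)
      then show ?thesis using False by (simp add: pos_divide_le_eq power2_norm_eq_inner)
    qed
    \<comment> \<open>The residual of the eigenvalue equation at the maximiser; the aim is
      \<open>w = 0\<close>.\<close>
    define w where "w = f v - l *\<^sub>R v"
    have fvV: "f v \<in> V" using vV less.prems(2) by auto
    have wV: "w \<in> V" unfolding w_def
      using vV fvV less.prems(1) by (simp add: subspace_diff subspace_scale)
    define c where "c = l * (w \<bullet> w) - w \<bullet> f w"
    \<comment> \<open>First variation in the direction \<open>w\<close>: at \<open>v + t w\<close>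
      the gain over \<open>v\<close> that is linear in \<open>t\<close> is bounded by a quadratic
      term for every \<open>t\<close>.\<close>
    have key: "2 * t * (w \<bullet> w) \<le> t\<^sup>2 * c" for t
    proof -
      have "v + t *\<^sub>R w \<in> V" using vV wV less.prems(1) by (simp add: subspace_add subspace_scale)
      from max[OF this] have "(v + t *\<^sub>R w) \<bullet> (f v + t *\<^sub>R f w) \<le> l * ((v + t *\<^sub>R w) \<bullet> (v + t *\<^sub>R w))"
        by (simp add: f.add f.scale)
      moreover have "v \<bullet> f w = w \<bullet> f v" using sym[of v w] by (simp add: inner_commute)
      moreover have "w \<bullet> f v = w \<bullet> w + l * (w \<bullet> v)"
      proof -
        have "f v = w + l *\<^sub>R v" by (simp add: w_def)
        then show ?thesis by (simp only: inner_add_right inner_scaleR_right)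
      qed
      moreover have "v \<bullet> v = 1" using nv by (simp add: dot_square_norm)
      ultimately show ?thesis
        by (simp add: c_def l_def[symmetric] inner_add_left inner_add_right inner_commute[of v w]
            algebra_simps power2_eq_square)
    qed
    have "w \<bullet> w = 0"
    proof (rule ccontr)
      assume "w \<bullet> w \<noteq> 0"
      then have pos: "w \<bullet> w > 0" using inner_ge_zero[of w] by linarith
      \<comment> \<open>Small enough that the quadratic side, after division by \<open>t\<close>, is
        at most \<open>w \<bullet> w\<close>, while the linear side is twice that. The summand 1
        keeps the denominator positive.\<close>
      define t where "t = (w \<bullet> w) / (\<bar>c\<bar> + 1)"
      have t: "t > 0" using pos by (simp add: t_def)
      have "t * (2 * (w \<bullet> w)) \<le> t * (t * c)" using key[of t] by (simp add: power2_eq_square mult_ac)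
      then have "2 * (w \<bullet> w) \<le> t * c" using t by simp
      also have "\<dots> \<le> t * (\<bar>c\<bar> + 1)" using t by (intro mult_left_mono) auto
      also have "\<dots> = w \<bullet> w" unfolding t_def by (simp add: add_nonneg_eq_0_iff)
      finally show False using pos by simp
    qed
    then have fv: "f v = l *\<^sub>R v" by (simp add: w_def)
    define V' where "V' = {x \<in> V. v \<bullet> x = 0}"
    have sub: "subspace V'" unfolding V'_def using less.prems(1)
      by (auto simp: subspace_def inner_add_right)
    have inv: "f ` V' \<subseteq> V'"
    proof -
      have "v \<bullet> f x = 0" if "v \<bullet> x = 0" for x
        using sym[of v x] fv that by simp
      then show ?thesis using less.prems(2) by (auto simp: V'_def)
    qed
    have "dim V' < dim V"
    proof (rule dim_psubset)
      have "v \<notin> V'" using nv by (auto simp: V'_def)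
      moreover have "V' \<subseteq> V" by (auto simp: V'_def)
      ultimately have "V' \<subset> V" using vV by blast
      then show "span V' \<subset> span V" using sub less.prems(1) by (simp add: span_eq_iff[THEN iffD2])
    qed
    from less.hyps[OF this sub inv] obtain B where B: "finite B" "B \<subseteq> V'" "V' \<subseteq> span B"
      "pairwise orthogonal B" "\<forall>b\<in>B. norm b = 1 \<and> f b = (b \<bullet> f b) *\<^sub>R b" by blast
    have "V \<subseteq> span (insert v B)"
    proof
      fix x assume x: "x \<in> V"
      have "x - (v \<bullet> x) *\<^sub>R v \<in> V'"
        using x vV nv less.prems(1)
        by (auto simp: V'_def subspace_diff subspace_scale inner_diff_right dot_square_norm)
      then show "x \<in> span (insert v B)" using B(3) by (auto simp: span_breakdown_eq)
    qed
    moreover have "pairwise orthogonal (insert v B)"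
      using B(2,4) by (auto simp: pairwise_insert orthogonal_def V'_def inner_commute)
    ultimately show ?thesis
      using B nv vV fv by (intro exI[of _ "insert v B"]) (auto simp: V'_def l_def)
  qed
qed

text \<open>In an orthonormal eigenbasis, replace each eigenvalue
  \<open>b \<bullet> (A *v b)\<close>, which is nonnegative, by its square root.\<close>

lemma psd_sqrt_exists:
  fixes A :: "real^'n^'n"
  assumes "psd A"
  shows "\<exists>B. psd B \<and> B ** B = A"
proof -
  have sym: "(A *v x) \<bullet> y = x \<bullet> (A *v y)" for x y
    using assms by (simp add: psd_def transpose_eq_iff_inner)
  obtain B where B: "finite B" "UNIV \<subseteq> span B" "pairwise orthogonal B"
    and eig: "\<And>b. b \<in> B \<Longrightarrow> norm b = 1" "\<And>b. b \<in> B \<Longrightarrow> A *v b = (b \<bullet> (A *v b)) *\<^sub>R b"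
    using selfadjoint_orthonormal_eigenbasis[OF matrix_vector_mul_linear[of A] sym, of UNIV] by auto
  define s where "s b = sqrt (b \<bullet> (A *v b))" for b
  define g where "g x = (\<Sum>b\<in>B. (s b * (x \<bullet> b)) *\<^sub>R b)" for x
  have expand: "(\<Sum>b\<in>B. (x \<bullet> b) *\<^sub>R b) = x" for x
    using orthonormal_basis_expand[OF B(3) eig(1) _ B(1)] B(2) by auto
  have s: "s b \<ge> 0" "s b * s b = b \<bullet> (A *v b)" for b
    using assms by (auto simp: s_def psd_def)
  have lin: "linear g"
    by (rule linearI) (simp_all add: g_def inner_add_left algebra_simps sum.distrib scaleR_sum_right)
  have "g b = s b *\<^sub>R b" if "b \<in> B" for b
  proof -
    have "g b = (\<Sum>c\<in>B. if c = b then s b *\<^sub>R b else 0)"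
      unfolding g_def
      by (rule sum.cong) (use B(3) eig(1) that in \<open>auto simp: pairwise_def orthogonal_def dot_square_norm\<close>)
    then show ?thesis using that B(1) by simp
  qed
  moreover have "A *v b = (s b * s b) *\<^sub>R b" if "b \<in> B" for b
    using eig(2)[OF that] by (simp only: s(2))
  ultimately have "g (g x) = A *v (\<Sum>b\<in>B. (x \<bullet> b) *\<^sub>R b)" for x
    unfolding g_def[of x] linear_sum[OF lin] linear_sum[OF matrix_vector_mul_linear]
    by (intro sum.cong refl) (simp add: linear_scale[OF lin] matrix_vector_mult_scaleR mult_ac)
  then have gg: "g (g x) = A *v x" for x by (simp add: expand)
  have mg: "matrix g *v x = g x" for x using lin by (simp add: matrix_works)
  have "psd (matrix g)"
    unfolding psd_def transpose_eq_iff_inner mg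
    using s(1) by (auto simp: g_def inner_sum_left inner_sum_right inner_commute mult_ac intro!: sum_nonneg)
  moreover have "matrix g ** matrix g = A"
    by (simp add: matrix_eq mg gg flip: matrix_vector_mul_assoc)
  ultimately show ?thesis by blast
qed

text \<open>With a root \<open>L\<close> of \<open>A\<close>, the form at \<open>x\<close> is the
  squared norm of \<open>L *v x\<close>.\<close>

lemma psd_kernel:
  assumes "psd A" "x \<bullet> (A *v x) = 0"
  shows "A *v x = 0"
proof -
  obtain L where L: "psd L" "L ** L = A" using psd_sqrt_exists assms(1) by blast
  have "(L *v x) \<bullet> (L *v x) = x \<bullet> (A *v x)"
    using L(1) unfolding psd_def transpose_eq_iff_inner L(2)[symmetric] matrix_vector_mul_assoc[symmetric]
    by blast
  then have "L *v x = 0" using assms(2) by simp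
  then show ?thesis by (simp flip: L(2) matrix_vector_mul_assoc)
qed

text \<open>For \<open>E = B - D\<close> the difference of the squares is \<open>B E + E D\<close>.
  Cyclicity of the trace turns its vanishing into the vanishing of two semidefinite forms, so
  \<open>B\<close> and \<open>D\<close> both annihilate the columns of \<open>E\<close>. Hence
  \<open>E E = 0\<close>, and \<open>E = 0\<close> by symmetry.\<close>

lemma psd_sqrt_unique:
  fixes B D :: "real^'n^'n"
  assumes B: "psd B" and D: "psd D" and eq: "B ** B = D ** D"
  shows "B = D"
proof -
  define E where "E = B - D"
  have symB: "(B *v x) \<bullet> y = x \<bullet> (B *v y)" and symD: "(D *v x) \<bullet> y = x \<bullet> (D *v y)" for x y
    using B D by (simp_all add: psd_def transpose_eq_iff_inner)
  have E: "E *v x = B *v x - D *v x" for x by (simp add: E_def algebra_simps)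
  have symE: "(E *v x) \<bullet> y = x \<bullet> (E *v y)" for x y
    by (simp add: E symB symD inner_diff_left inner_diff_right)
  have nn: "0 \<le> x \<bullet> (E *v (B *v (E *v x)))" "0 \<le> x \<bullet> (E *v (D *v (E *v x)))" for x
    using B D by (auto simp: symE[symmetric] psd_def)
  \<comment> \<open>Multiplying \<open>B E + E D = 0\<close> by \<open>E\<close> and taking traces, \<open>E B E\<close> and \<open>E D E\<close> have diagonal 0.\<close>
  have "B ** E + E ** D = 0"
    using eq by (simp add: matrix_eq E matrix_vector_mult_diff_distrib matrix_vector_mult_add_rdistrib
        flip: matrix_vector_mul_assoc)
  then have "trace (E ** (B ** E + E ** D)) = 0" by (simp add: trace_def)
  then have "trace (E ** (B ** E)) + trace (E ** (D ** E)) = 0"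
    by (metis matrix_add_ldistrib matrix_mul_assoc trace_add trace_mul_sym)
  then have "(\<Sum>i\<in>UNIV. axis i 1 \<bullet> (E *v (B *v (E *v axis i 1))) + axis i 1 \<bullet> (E *v (D *v (E *v axis i 1)))) = 0"
    by (simp add: trace_eq_sum_inner sum.distrib flip: matrix_vector_mul_assoc)
  then have z: "axis i 1 \<bullet> (E *v (B *v (E *v axis i 1))) + axis i 1 \<bullet> (E *v (D *v (E *v axis i 1))) = 0" for i
    using nn by (subst (asm) sum_nonneg_eq_0_iff) (auto intro: add_nonneg_nonneg)
  have "E *v axis i 1 = 0" for i
  proof -
    have "(E *v axis i 1) \<bullet> (B *v (E *v axis i 1)) = 0" "(E *v axis i 1) \<bullet> (D *v (E *v axis i 1)) = 0"
      using z[of i] nn[of "axis i 1"] by (auto simp: symE)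
    then have "E *v (E *v axis i 1) = 0"
      by (simp add: E[of "E *v _"] psd_kernel[OF B] psd_kernel[OF D])
    then have "(E *v axis i 1) \<bullet> (E *v axis i 1) = 0" by (simp add: symE)
    then show ?thesis by simp
  qed
  then have "E = 0" by (simp add: matrix_vector_mult_basis column_def vec_eq_iff)
  then show ?thesis unfolding E_def by simp
qed

text \<open>Existence and uniqueness together give the \<open>THE\<close> in \<open>psd_sqrt\<close>
  its meaning.\<close>

lemma
  assumes "psd A"
  shows psd_psd_sqrt: "psd (psd_sqrt A)" and psd_sqrt_square: "psd_sqrt A ** psd_sqrt A = A"
proof -
  obtain B where B: "psd B" "B ** B = A" using psd_sqrt_exists[OF assms] by blast
  have "psd_sqrt A = B"
    unfolding psd_sqrt_def
  proof (rule the_equality)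
    show "psd B \<and> B ** B = A" using B by simp
    show "D = B" if "psd D \<and> D ** D = A" for D
      by (rule psd_sqrt_unique) (use B that in simp_all)
  qed
  with B show "psd (psd_sqrt A)" "psd_sqrt A ** psd_sqrt A = A" by (simp_all only:)
qed

section \<open>The quadratic form of the block matrix\<close>

text \<open>These rules trade transposes for \<open>v*\<close>. Below, transposes have to stay
  visible so that the adjoint rules for inner products apply.\<close>

declare transpose_matrix_vector [simp del] vector_transpose_matrix [simp del]

text \<open>Stacked vectors, indexed by the same sum types as \<open>hcat\<close> and
  \<open>vcat\<close> and nested to the right like the blocks of \<open>utility_lmi\<close>.\<close>

definition vapp :: "'a^'m \<Rightarrow> 'a^'n \<Rightarrow> 'a^('m + 'n)" (infixr "@@@" 63) where
  "u @@@ v = (\<chi> i. case i of Inl a \<Rightarrow> u $ a | Inr b \<Rightarrow> v $ b)"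

lemma sum_UNIV_sum: "(\<Sum>i\<in>UNIV. f i) = (\<Sum>a\<in>UNIV. f (Inl a)) + (\<Sum>b\<in>UNIV. f (Inr b))"
  for f :: "'a::finite + 'b::finite \<Rightarrow> 'c::comm_monoid_add"
  using sum.Plus[of "UNIV :: 'a set" "UNIV :: 'b set" f] by simp

lemma ex_vapp: "\<exists>u v. x = u @@@ v"
proof (intro exI)
  show "x = (\<chi> a. x $ Inl a) @@@ (\<chi> b. x $ Inr b)"
    by (simp add: vapp_def vec_eq_iff split: sum.split)
qed

lemma ex_vapp4: "\<exists>u v w z. x = u @@@ v @@@ w @@@ z"
proof -
  obtain u r where "x = u @@@ r" using ex_vapp[of x] by blast
  moreover obtain v s where "r = v @@@ s" using ex_vapp[of r] by blast
  moreover obtain w z where "s = w @@@ z" using ex_vapp[of s] by blast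
  ultimately show ?thesis by blast
qed

lemma inner_vapp: "(u @@@ v) \<bullet> (u' @@@ v') = u \<bullet> u' + v \<bullet> v'" for u :: "real^'m" and v :: "real^'n"
  by (simp add: inner_vec_def vapp_def sum_UNIV_sum)

lemma hcat_mult_vapp: "(A ||| B) *v (u @@@ v) = A *v u + B *v v"
  by (simp add: hcat_def vapp_def matrix_vector_mult_def vec_eq_iff sum_UNIV_sum)

lemma vcat_mult_vec: "(A === B) *v x = (A *v x) @@@ (B *v x)"
  by (simp add: vcat_def vapp_def matrix_vector_mult_def vec_eq_iff split: sum.split)

lemma transpose_diff: "transpose (A - B) = transpose A - transpose B" for A :: "'a::ab_group_add^'n^'m"
  by (simp add: transpose_def vec_eq_iff)

lemma utility_lmi_mult_vapp:
  "utility_lmi P C Rs Mu S Q K *v (u @@@ v @@@ w @@@ z) =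
    (Q *v u + (Mu ** (mat 1 - K ** C) ** psd_sqrt P) *v v + (Mu ** K) *v w + (Mu ** K) *v z) @@@
    ((psd_sqrt P ** transpose (mat 1 - K ** C) ** transpose Mu) *v u + v) @@@
    ((transpose K ** transpose Mu) *v u + matrix_inv Rs *v w) @@@
    ((transpose K ** transpose Mu) *v u + S *v z)"
  by (simp add: utility_lmi_def vcat_mult_vec hcat_mult_vapp add.assoc)

text \<open>The gain enters only through \<open>k\<close> and \<open>h\<close>, the images of
  \<open>u\<close> under the transposes of \<open>Mu K\<close> and
  \<open>Mu (I - K C) sqrt P\<close>. Two independent arguments are kept because symmetry of the
  block matrix is read off from the bilinear form as well.\<close>

lemma inner_utility_lmi:
  fixes P :: "real^'n^'n" and C :: "real^'n^'m" and Mu :: "real^'n^'r" and K :: "real^'m^'n"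
  assumes "transpose (psd_sqrt P) = psd_sqrt P"
  defines "k \<equiv> \<lambda>u. transpose K *v (transpose Mu *v u)"
  defines "h \<equiv> \<lambda>u. psd_sqrt P *v (transpose Mu *v u - transpose C *v k u)"
  shows "(u' @@@ v' @@@ w' @@@ z') \<bullet> (utility_lmi P C Rs Mu S Q K *v (u @@@ v @@@ w @@@ z)) =
    u' \<bullet> (Q *v u) + h u' \<bullet> v + h u \<bullet> v' + k u' \<bullet> w + k u \<bullet> w' + k u' \<bullet> z + k u \<bullet> z'
    + v \<bullet> v' + w' \<bullet> (matrix_inv Rs *v w) + z' \<bullet> (S *v z)"
proof -
  let ?T = "psd_sqrt P ** transpose (mat 1 - K ** C) ** transpose Mu"
  have T: "Mu ** (mat 1 - K ** C) ** psd_sqrt P = transpose ?T"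
    by (simp add: matrix_transpose_mul assms(1) matrix_mul_assoc)
  have "transpose (mat 1 - K ** C) = mat 1 - transpose C ** transpose K"
    by (simp add: transpose_diff matrix_transpose_mul)
  then have h: "?T *v u = h u" for u
    by (simp add: h_def k_def matrix_vector_mult_diff_rdistrib flip: matrix_vector_mul_assoc)
  have "u' \<bullet> (transpose ?T *v v) = h u' \<bullet> v"
    by (metis h inner_transpose_left inner_commute)
  moreover have "u' \<bullet> ((Mu ** K) *v w) = k u' \<bullet> w" for w
    by (simp add: k_def inner_transpose_left flip: matrix_vector_mul_assoc)
  ultimately show ?thesis
    unfolding utility_lmi_mult_vapp inner_vapp T h
    by (simp add: inner_add_left inner_add_right k_def inner_commute flip: matrix_vector_mul_assoc)
qed

section \<open>The posterior covariance for singular precisions\<close>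

lemma psd_symD: "psd A \<Longrightarrow> (A *v x) \<bullet> y = x \<bullet> (A *v y)"
  by (simp add: psd_def transpose_eq_iff_inner)

lemma psdI:
  assumes "\<And>x y. (A *v x) \<bullet> y = x \<bullet> (A *v y)" "\<And>x. 0 \<le> x \<bullet> (A *v x)"
  shows "psd A"
  using assms unfolding psd_def transpose_eq_iff_inner by blast

lemma inner_mult_transpose_right: "x \<bullet> (transpose A *v y) = (A *v x) \<bullet> y" for A :: "real^'n^'m"
  by (metis inner_transpose_left inner_commute)

definition posdef :: "real^'n^'n \<Rightarrow> bool" where
  "posdef A \<longleftrightarrow> transpose A = A \<and> (\<forall>x. x \<noteq> 0 \<longrightarrow> 0 < x \<bullet> (A *v x))"

lemma posdef_imp_psd: "posdef A \<Longrightarrow> psd A"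
  unfolding posdef_def psd_def by (metis inner_zero_left less_eq_real_def)

lemma posdef_diagonal:
  fixes A :: "real^'n^'n"
  assumes "\<And>i j. i \<noteq> j \<Longrightarrow> A $ i $ j = 0" "\<And>i. 0 < A $ i $ i"
  shows "posdef A"
proof -
  have "transpose A = A"
    using assms(1) by (simp add: vec_eq_iff transpose_def) metis
  moreover have "0 < x \<bullet> (A *v x)" if "x \<noteq> 0" for x
  proof -
    have "(A *v x) $ i = A $ i $ i * x $ i" for i
    proof -
      have "(A *v x) $ i = (\<Sum>j\<in>UNIV. if j = i then A $ i $ i * x $ i else 0)"
        unfolding matrix_vector_mult_def vec_lambda_beta
        by (rule sum.cong) (auto simp: assms(1))
      then show ?thesis by simp
    qed
    then have "x \<bullet> (A *v x) = (\<Sum>i\<in>UNIV. A $ i $ i * (x $ i)\<^sup>2)"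
      by (simp add: inner_vec_def power2_eq_square mult_ac)
    moreover have "\<exists>i. x $ i \<noteq> 0" using that by (simp add: vec_eq_iff)
    then obtain i where "x $ i \<noteq> 0" ..
    then have "0 < (\<Sum>i\<in>UNIV. A $ i $ i * (x $ i)\<^sup>2)"
      using assms(2) less_imp_le[OF assms(2)] by (intro sum_pos2[of _ i]) simp_all
    ultimately show ?thesis by simp
  qed
  ultimately show ?thesis by (simp add: posdef_def)
qed

lemma posdef_mat: "0 < c \<Longrightarrow> posdef (c *\<^sub>R mat 1 :: real^'n^'n)"
  by (rule posdef_diagonal) (simp_all add: mat_def)

lemma psd_add_posdef:
  assumes "psd A" "posdef B"
  shows "posdef (A + B)"
proof -
  have "transpose A = A" "transpose B = B"
    using assms unfolding psd_def posdef_def by blast+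
  then have "transpose (A + B) = A + B"
    by (simp add: transpose_def vec_eq_iff)
  moreover have "0 < x \<bullet> ((A + B) *v x)" if "x \<noteq> 0" for x
  proof -
    have "0 \<le> x \<bullet> (A *v x)" "0 < x \<bullet> (B *v x)"
      using assms that unfolding psd_def posdef_def by blast+
    then show ?thesis by (simp add: matrix_vector_mult_add_rdistrib inner_add_right)
  qed
  ultimately show ?thesis unfolding posdef_def by blast
qed

lemma psd_congruence:
  assumes "psd A"
  shows "psd (B ** A ** transpose B)"
proof (rule psdI)
  fix x y
  show "((B ** A ** transpose B) *v x) \<bullet> y = x \<bullet> ((B ** A ** transpose B) *v y)"
    using psd_symD[OF assms, of "transpose B *v x" "transpose B *v y"]
    by (simp only: inner_mult_transpose_right inner_transpose_left matrix_vector_mul_assoc[symmetric])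
  have "0 \<le> (transpose B *v x) \<bullet> (A *v (transpose B *v x))"
    using assms by (simp only: psd_def)
  then show "0 \<le> x \<bullet> ((B ** A ** transpose B) *v x)"
    by (simp only: inner_transpose_left matrix_vector_mul_assoc[symmetric])
qed

lemma posdef_invertible: "posdef A \<Longrightarrow> invertible A"
  by (rule invertibleI_kernel) (force simp: posdef_def)

lemma posdef_matrix_inv_psd:
  assumes "posdef A"
  shows "psd (matrix_inv A)"
proof -
  have A: "A *v (matrix_inv A *v x) = x" for x
    by (simp add: matrix_vector_mul_assoc matrix_inv_mult_right posdef_invertible assms)
  have "psd A" using assms by (rule posdef_imp_psd)
  show ?thesis
  proof (rule psdI)
    fix x y
    show "(matrix_inv A *v x) \<bullet> y = x \<bullet> (matrix_inv A *v y)"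
      using psd_symD[OF \<open>psd A\<close>, of "matrix_inv A *v x" "matrix_inv A *v y"] by (simp add: A)
    have "0 \<le> (matrix_inv A *v x) \<bullet> (A *v (matrix_inv A *v x))"
      using \<open>psd A\<close> by (simp only: psd_def)
    then show "0 \<le> x \<bullet> (matrix_inv A *v x)" by (simp add: A inner_commute)
  qed
qed

text \<open>Pairing \<open>y + A S y = 0\<close> with \<open>S y\<close> gives two nonnegative terms
  of sum 0. Definiteness of \<open>A\<close> then forces \<open>S y = 0\<close>, and the equation
  leaves \<open>y = 0\<close>.\<close>

lemma invertible_one_plus_posdef_mult_psd:
  assumes A: "posdef A" and S: "psd S"
  shows "invertible (mat 1 + A ** S)"
proof (rule invertibleI_kernel)
  fix y assume "(mat 1 + A ** S) *v y = 0"
  then have y: "y + A *v (S *v y) = 0"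
    by (simp add: matrix_vector_mult_add_rdistrib flip: matrix_vector_mul_assoc)
  then have "(y + A *v (S *v y)) \<bullet> (S *v y) = 0" by simp
  then have "y \<bullet> (S *v y) + (S *v y) \<bullet> (A *v (S *v y)) = 0"
    by (simp only: inner_add_left inner_commute[of "A *v _"])
  moreover have "0 \<le> y \<bullet> (S *v y)" using S by (simp add: psd_def)
  ultimately have "\<not> 0 < (S *v y) \<bullet> (A *v (S *v y))" by simp
  then have "S *v y = 0" using A unfolding posdef_def by blast
  with y show "y = 0" by simp
qed

text \<open>For invertible \<open>S\<close> this is the inverse of \<open>A + matrix_inv S\<close>; unlike the latter
  expression it makes sense, and is continuous in \<open>S\<close>, for every positive semidefinite \<open>S\<close>.\<close>

definition innovation_prec :: "real^'m^'m \<Rightarrow> real^'m^'m \<Rightarrow> real^'m^'m" where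
  "innovation_prec A S = S ** matrix_inv (mat 1 + A ** S)"

lemma matrix_inv_add_matrix_inv:
  assumes "posdef A" "psd S" "invertible S"
  shows "matrix_inv (A + matrix_inv S) = innovation_prec A S"
proof (rule matrix_inv_unique)
  have "(A + matrix_inv S) ** S = mat 1 + A ** S"
    using matrix_inv_mult_left[OF assms(3)]
    by (simp add: matrix_eq matrix_vector_mult_add_rdistrib add.commute flip: matrix_vector_mul_assoc)
  then show "(A + matrix_inv S) ** innovation_prec A S = mat 1"
    unfolding innovation_prec_def matrix_mul_assoc
    using matrix_inv_mult_right[OF invertible_one_plus_posdef_mult_psd[OF assms(1,2)]] by simp
qed

text \<open>Removes the inverse from later computations: \<open>y\<close> solves
  \<open>(I + A S) y = g\<close>, and everything is expressed through \<open>y\<close> and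
  \<open>S y\<close>.\<close>

lemma innovation_prec_decompose:
  assumes "posdef A" "psd S"
  obtains y where "g = A *v (S *v y) + y" "innovation_prec A S *v g = S *v y"
proof
  let ?y = "matrix_inv (mat 1 + A ** S) *v g"
  have "(mat 1 + A ** S) *v ?y = g"
    using matrix_inv_mult_right[OF invertible_one_plus_posdef_mult_psd[OF assms]]
    by (simp add: matrix_vector_mul_assoc)
  then show "g = A *v (S *v ?y) + ?y"
    by (simp add: matrix_vector_mult_add_rdistrib add.commute flip: matrix_vector_mul_assoc)
  show "innovation_prec A S *v g = S *v ?y"
    by (simp add: innovation_prec_def matrix_vector_mul_assoc)
qed

text \<open>The product form hides the symmetry. In terms of the solutions \<open>y\<close> and
  \<open>y'\<close> both sides become \<open>S y \<bullet> A S y' + y \<bullet> S y'\<close>, by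
  symmetry of \<open>A\<close> and \<open>S\<close>.\<close>

lemma innovation_prec_sym:
  assumes A: "posdef A" and S: "psd S"
  shows "(innovation_prec A S *v g) \<bullet> g' = g \<bullet> (innovation_prec A S *v g')"
proof -
  obtain y where y: "g = A *v (S *v y) + y" "innovation_prec A S *v g = S *v y"
    using innovation_prec_decompose[OF assms] .
  obtain y' where y': "g' = A *v (S *v y') + y'" "innovation_prec A S *v g' = S *v y'"
    using innovation_prec_decompose[OF assms] .
  have "(S *v y) \<bullet> (A *v (S *v y') + y') = (A *v (S *v y) + y) \<bullet> (S *v y')"
    using psd_symD[OF S, of y y'] psd_symD[OF posdef_imp_psd[OF A], of "S *v y" "S *v y'"]
    by (simp add: inner_add_left inner_add_right)
  then show ?thesis by (simp only: y(2) y'(2) flip: y(1) y'(1))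
qed

lemma tendsto_matrix_mult:
  fixes f :: "'b \<Rightarrow> real^'n^'m" and g :: "'b \<Rightarrow> real^'k^'n"
  assumes "(f \<longlongrightarrow> A) F" "(g \<longlongrightarrow> B) F"
  shows "((\<lambda>x. f x ** g x) \<longlongrightarrow> A ** B) F"
  unfolding matrix_matrix_mult_def by (intro tendsto_intros assms)

lemma tendsto_innovation_prec:
  assumes "posdef A" "psd S" and f: "(f \<longlongrightarrow> S) F"
  shows "((\<lambda>x. innovation_prec A (f x)) \<longlongrightarrow> innovation_prec A S) F"
  unfolding innovation_prec_def
  by (intro tendsto_matrix_mult tendsto_matrix_inv tendsto_add tendsto_const f
      invertible_one_plus_posdef_mult_psd assms)

text \<open>One formula for both branches of the definition. For \<epsilon> > 0 the regularised
  precision is positive definite, so the invertible case applies to it, and continuity of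
  \<open>innovation_prec\<close> identifies the limit.\<close>

lemma posterior_cov_of_precision_eq:
  fixes P :: "real^'n^'n" and C :: "real^'n^'m" and Mu :: "real^'n^'r"
  assumes "psd P" "posdef Rs" "psd S"
  defines "A \<equiv> C ** P ** transpose C + Rs"
  defines "X \<equiv> \<lambda>Y. Mu ** P ** transpose Mu
      - Mu ** P ** transpose C ** Y ** C ** P ** transpose Mu"
  shows "posterior_cov_of_precision P C Rs Mu S = X (innovation_prec A S)"
proof -
  have A: "posdef A" unfolding A_def by (intro psd_add_posdef psd_congruence assms)
  have X: "posterior_cov P C Rs Mu (matrix_inv T) = X (innovation_prec A T)"
    if "psd T" "invertible T" for T
    using matrix_inv_add_matrix_inv[OF A that] by (simp add: posterior_cov_def X_def A_def)
  show ?thesis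
  proof (cases "invertible S")
    case True
    then show ?thesis using X assms(3) by (simp add: posterior_cov_of_precision_def)
  next
    case False
    let ?S = "\<lambda>\<epsilon>::real. S + \<epsilon> *\<^sub>R mat 1"
    have "(?S \<longlongrightarrow> S + 0 *\<^sub>R mat 1) (at_right 0)" by (intro tendsto_intros)
    then have "(?S \<longlongrightarrow> S) (at_right 0)" by simp
    then have "((\<lambda>\<epsilon>. X (innovation_prec A (?S \<epsilon>))) \<longlongrightarrow> X (innovation_prec A S)) (at_right 0)"
      unfolding X_def
      by (intro tendsto_diff tendsto_matrix_mult tendsto_const tendsto_innovation_prec A assms)
    moreover have "\<forall>\<^sub>F \<epsilon> in at_right 0. X (innovation_prec A (?S \<epsilon>)) = posterior_cov P C Rs Mu (matrix_inv (?S \<epsilon>))"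
      using eventually_at_right_less
      by eventually_elim
        (metis X psd_add_posdef posdef_mat posdef_imp_psd posdef_invertible assms(3))
    ultimately have "((\<lambda>\<epsilon>. posterior_cov P C Rs Mu (matrix_inv (?S \<epsilon>))) \<longlongrightarrow> X (innovation_prec A S)) (at_right 0)"
      using tendsto_cong by fast
    then show ?thesis
      using False by (simp add: posterior_cov_of_precision_def tendsto_Lim)
  qed
qed

text \<open>The data shared by both directions of the equivalence. The first equation is
  \<open>(I + A S) y = C L f\<close> written out with \<open>P = L L\<close>; the second says how
  the Kalman gain \<open>G\<close> acts on \<open>u\<close>.\<close>

lemma posterior_cov_of_precision_quadratic:
  fixes P :: "real^'n^'n" and C :: "real^'n^'m" and Mu :: "real^'n^'r"
  assumes P: "psd P" and Rs: "posdef Rs" and S: "psd S"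
  defines "L \<equiv> psd_sqrt P"
  defines "G \<equiv> P ** transpose C ** innovation_prec (C ** P ** transpose C + Rs) S"
  defines "f \<equiv> \<lambda>u. L *v (transpose Mu *v u)"
  obtains y where
    "C *v (L *v f u) = C *v (L *v (L *v (transpose C *v (S *v y)))) + Rs *v (S *v y) + y"
    "transpose G *v (transpose Mu *v u) = S *v y"
    "u \<bullet> (posterior_cov_of_precision P C Rs Mu S *v u) = f u \<bullet> f u - (C *v (L *v f u)) \<bullet> (S *v y)"
proof -
  define A where "A = C ** P ** transpose C + Rs"
  have A: "posdef A" unfolding A_def by (intro psd_add_posdef psd_congruence assms)
  have LL: "P *v x = L *v (L *v x)" for x
    by (simp add: L_def matrix_vector_mul_assoc psd_sqrt_square P)
  have L: "(L *v x) \<bullet> x' = x \<bullet> (L *v x')" for x x'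
    by (simp add: L_def psd_symD psd_psd_sqrt P)
  obtain y where y: "C *v (L *v f u) = A *v (S *v y) + y"
    "innovation_prec A S *v (C *v (L *v f u)) = S *v y"
    using innovation_prec_decompose[OF A S] .
  have "transpose G *v (transpose Mu *v u) = S *v y"
  proof (rule vector_eq_rdot[THEN iffD1], rule allI)
    fix x
    have "(transpose G *v (transpose Mu *v u)) \<bullet> x
        = (L *v f u) \<bullet> (transpose C *v (innovation_prec A S *v x))"
      unfolding G_def A_def[symmetric] f_def L
      by (simp only: inner_transpose_left L matrix_vector_mul_assoc[symmetric] LL)
    also have "\<dots> = (innovation_prec A S *v (C *v (L *v f u))) \<bullet> x"
      by (simp only: inner_mult_transpose_right innovation_prec_sym[OF A S])
    finally have "(transpose G *v (transpose Mu *v u)) \<bullet> x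
        = (innovation_prec A S *v (C *v (L *v f u))) \<bullet> x" .
    then show "(transpose G *v (transpose Mu *v u)) \<bullet> x = (S *v y) \<bullet> x" by (simp only: y(2))
  qed
  moreover have "posterior_cov_of_precision P C Rs Mu S *v u
      = Mu *v (L *v f u) - Mu *v (L *v (L *v (transpose C *v (S *v y))))"
    unfolding posterior_cov_of_precision_eq[OF P Rs S] A_def[symmetric] y(2)[symmetric]
    by (simp add: matrix_vector_mult_diff_rdistrib f_def LL flip: matrix_vector_mul_assoc)
  then have "u \<bullet> (posterior_cov_of_precision P C Rs Mu S *v u)
      = f u \<bullet> f u - f u \<bullet> (L *v (transpose C *v (S *v y)))"
    by (simp add: inner_diff_right f_def L inner_transpose_left)
  then have "u \<bullet> (posterior_cov_of_precision P C Rs Mu S *v u)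
      = f u \<bullet> f u - (C *v (L *v f u)) \<bullet> (S *v y)"
    by (simp add: inner_mult_transpose_right flip: L)
  moreover have "C *v (L *v f u) = C *v (L *v (L *v (transpose C *v (S *v y)))) + Rs *v (S *v y) + y"
    unfolding y(1) by (simp add: A_def matrix_vector_mult_add_rdistrib LL flip: matrix_vector_mul_assoc)
  ultimately show ?thesis using that by blast
qed

section \<open>Equivalence of the matrix inequality and the utility constraint\<close>

text \<open>The ordinary Schur complement would need \<open>S\<close> to be invertible; one test
  vector for each \<open>u\<close> replaces it and gives the comparison of quadratic forms behind
  the trace bound.\<close>

lemma feasible_imp_trace_posterior_le:
  fixes P :: "real^'n^'n" and C :: "real^'n^'m" and Mu :: "real^'n^'r"
  assumes P: "psd P" and Rs: "posdef Rs" and feas: "feasible P C Rs Mu \<gamma> (S, Q, K)"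
  shows "trace (posterior_cov_of_precision P C Rs Mu S) \<le> \<gamma>"
proof -
  have S: "psd S" and lmi: "psd (utility_lmi P C Rs Mu S Q K)" and tr: "trace Q \<le> \<gamma>"
    using feas by (auto simp: feasible_def)
  define L where "L = psd_sqrt P"
  have symL: "transpose L = L" using psd_psd_sqrt[OF P] by (simp add: L_def psd_def)
  then have L: "(L *v x) \<bullet> x' = x \<bullet> (L *v x')" for x x'
    unfolding transpose_eq_iff_inner by blast
  have "u \<bullet> (posterior_cov_of_precision P C Rs Mu S *v u) \<le> u \<bullet> (Q *v u)" for u
  proof -
    define f k where "f = L *v (transpose Mu *v u)" and "k = transpose K *v (transpose Mu *v u)"
    obtain y where y: "C *v (L *v f) = C *v (L *v (L *v (transpose C *v (S *v y)))) + Rs *v (S *v y) + y"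
      and post: "u \<bullet> (posterior_cov_of_precision P C Rs Mu S *v u) = f \<bullet> f - (C *v (L *v f)) \<bullet> (S *v y)"
      unfolding f_def L_def
      by (rule posterior_cov_of_precision_quadratic[OF P Rs S, of C Mu u])
    define x where "x = S *v y"
    define e where "e = L *v (transpose C *v x)"
    \<comment> \<open>The test vector is chosen such that the dependence on the gain \<open>K\<close> cancels.\<close>
    define v w z where "v = e - f" and "w = - (Rs *v x)" and "z = - y"
    have "0 \<le> (u @@@ v @@@ w @@@ z) \<bullet> (utility_lmi P C Rs Mu S Q K *v (u @@@ v @@@ w @@@ z))"
      using lmi by (simp only: psd_def)
    also have "\<dots> = u \<bullet> (Q *v u) + 2 * ((f - L *v (transpose C *v k)) \<bullet> v + k \<bullet> w + k \<bullet> z)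
        + v \<bullet> v + w \<bullet> (matrix_inv Rs *v w) + z \<bullet> (S *v z)"
      unfolding inner_utility_lmi[OF symL[unfolded L_def]]
      by (simp add: f_def k_def L_def matrix_vector_mult_diff_distrib)
    also have "(L *v (transpose C *v k)) \<bullet> v = k \<bullet> (C *v (L *v e)) - k \<bullet> (C *v (L *v f))"
      by (simp add: L inner_transpose_left v_def matrix_vector_mult_diff_distrib inner_diff_right)
    \<comment> \<open>All terms containing \<open>k\<close> add up to \<open>k\<close> paired with
      \<open>C L f - C L e - Rs x - y\<close>, which is zero by the equation for
      \<open>y\<close>.\<close>
    then have "(f - L *v (transpose C *v k)) \<bullet> v + k \<bullet> w + k \<bullet> z = f \<bullet> v"
      using arg_cong[OF y, of "\<lambda>r. k \<bullet> r"]
      by (simp add: inner_diff_left w_def z_def x_def[symmetric] e_def[symmetric] inner_add_right)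
    also have "matrix_inv Rs *v w = - x"
      using matrix_inv_mult_left[OF posdef_invertible[OF Rs]]
      by (simp add: w_def linear_neg[OF matrix_vector_mul_linear] matrix_vector_mul_assoc)
    also have "S *v z = - x" by (simp add: z_def x_def linear_neg[OF matrix_vector_mul_linear])
    finally have "0 \<le> u \<bullet> (Q *v u) + 2 * (f \<bullet> v) + v \<bullet> v + w \<bullet> (- x) + z \<bullet> (- x)" .
    \<comment> \<open>The equation for \<open>y\<close>, paired with \<open>x\<close>, collapses
      \<open>e \<bullet> e + Rs x \<bullet> x + y \<bullet> x\<close> to
      \<open>C L f \<bullet> x\<close>. What remains besides \<open>u \<bullet> Q u\<close> is minus
      the posterior form.\<close>
    moreover have "f \<bullet> e = (C *v (L *v f)) \<bullet> x"
      by (simp add: e_def inner_mult_transpose_right flip: L)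
    moreover have "e \<bullet> e = (C *v (L *v e)) \<bullet> x"
      by (simp add: e_def inner_mult_transpose_right flip: L)
    moreover have "(C *v (L *v f)) \<bullet> x = (C *v (L *v e)) \<bullet> x + (Rs *v x) \<bullet> x + y \<bullet> x"
      using y by (simp add: x_def[symmetric] e_def[symmetric] inner_add_left)
    moreover have "2 * (f \<bullet> v) + v \<bullet> v = e \<bullet> e - f \<bullet> f"
      by (simp add: v_def inner_diff_left inner_diff_right inner_commute[of e f])
    moreover have "w \<bullet> (- x) = (Rs *v x) \<bullet> x" "z \<bullet> (- x) = y \<bullet> x"
      by (simp_all add: w_def z_def)
    ultimately show ?thesis unfolding post x_def[symmetric] by linarith
  qed
  then have "trace (posterior_cov_of_precision P C Rs Mu S) \<le> trace Q" by (rule trace_mono)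
  then show ?thesis using tr by simp
qed

text \<open>With \<open>Q\<close> the posterior covariance itself, the trace constraint is the
  assumption, and only semidefiniteness of the block matrix remains to be shown.\<close>

lemma trace_posterior_le_imp_feasible:
  fixes P :: "real^'n^'n" and C :: "real^'n^'m" and Mu :: "real^'n^'r"
  assumes P: "psd P" and Rs: "posdef Rs" and S: "psd S"
    and tr: "trace (posterior_cov_of_precision P C Rs Mu S) \<le> \<gamma>"
  shows "\<exists>Q K. feasible P C Rs Mu \<gamma> (S, Q, K)"
proof -
  define L where "L = psd_sqrt P"
  have symL: "transpose L = L" using psd_psd_sqrt[OF P] by (simp add: L_def psd_def)
  then have L: "(L *v x) \<bullet> x' = x \<bullet> (L *v x')" for x x'
    unfolding transpose_eq_iff_inner by blast
  define A where "A = C ** P ** transpose C + Rs"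
  have A: "posdef A" unfolding A_def by (intro psd_add_posdef psd_congruence assms)
  define K where "K = P ** transpose C ** innovation_prec A S"
  define Q where "Q = posterior_cov_of_precision P C Rs Mu S"
  have "transpose P = P" "transpose (innovation_prec A S) = innovation_prec A S"
    using P innovation_prec_sym[OF A S] by (simp_all add: psd_def transpose_eq_iff_inner)
  then have symQ: "(Q *v u) \<bullet> u' = u \<bullet> (Q *v u')" for u u'
    unfolding Q_def posterior_cov_of_precision_eq[OF P Rs S] A_def[symmetric]
    by (simp add: matrix_vector_mult_diff_rdistrib inner_diff_left inner_diff_right
        inner_mult_transpose_right
        flip: matrix_vector_mul_assoc inner_transpose_left)
  have Ri: "psd (matrix_inv Rs)" by (rule posdef_matrix_inv_psd[OF Rs])
  let ?M = "utility_lmi P C Rs Mu S Q K"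
  have M: "psd ?M"
  proof (rule psdI)
    fix \<xi> \<eta> :: "real^('r + 'n + 'm + 'm)"
    obtain u v w z u' v' w' z' where \<xi>: "\<xi> = u @@@ v @@@ w @@@ z"
      and \<eta>: "\<eta> = u' @@@ v' @@@ w' @@@ z'"
      using ex_vapp4[of \<xi>] ex_vapp4[of \<eta>] by blast
    show "(?M *v \<xi>) \<bullet> \<eta> = \<xi> \<bullet> (?M *v \<eta>)"
      unfolding inner_commute[of "?M *v \<xi>"]
      unfolding \<xi> \<eta> inner_utility_lmi[OF symL[unfolded L_def]]
      using symQ[of u u'] psd_symD[OF Ri, of w w'] psd_symD[OF S, of z z']
      by (simp add: inner_commute)
  next
    fix \<xi> :: "real^('r + 'n + 'm + 'm)"
    obtain u v w z where \<xi>: "\<xi> = u @@@ v @@@ w @@@ z"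
      using ex_vapp4[of \<xi>] by blast
    define f where "f = L *v (transpose Mu *v u)"
    obtain y where y: "C *v (L *v f) = C *v (L *v (L *v (transpose C *v (S *v y)))) + Rs *v (S *v y) + y"
      and K: "transpose K *v (transpose Mu *v u) = S *v y"
      and post: "u \<bullet> (Q *v u) = f \<bullet> f - (C *v (L *v f)) \<bullet> (S *v y)"
      unfolding f_def L_def K_def A_def Q_def
      by (rule posterior_cov_of_precision_quadratic[OF P Rs S, of C Mu u])
    define x where "x = S *v y"
    define e where "e = L *v (transpose C *v x)"
    have "\<xi> \<bullet> (?M *v \<xi>) = u \<bullet> (Q *v u) + 2 * ((f - e) \<bullet> v + x \<bullet> w + x \<bullet> z)
        + v \<bullet> v + w \<bullet> (matrix_inv Rs *v w) + z \<bullet> (S *v z)"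
      unfolding \<xi> inner_utility_lmi[OF symL[unfolded L_def]] K
      by (simp add: f_def e_def x_def L_def matrix_vector_mult_diff_distrib)
    \<comment> \<open>Completing squares in \<open>v\<close>, \<open>w\<close> and \<open>z\<close>.
      The last one is possible for singular \<open>S\<close> because the coefficient
      \<open>x = S y\<close> of \<open>z\<close> lies in the range of \<open>S\<close>. The
      constants left over,
      \<open>(f - e) \<bullet> (f - e) + Rs x \<bullet> x + y \<bullet> x\<close>, sum to the
      posterior form by the equation for \<open>y\<close>.\<close>
    also have "\<dots> = (v + (f - e)) \<bullet> (v + (f - e))
        + (w + Rs *v x) \<bullet> (matrix_inv Rs *v (w + Rs *v x)) + (z + y) \<bullet> (S *v (z + y))"
    proof -
      have "f \<bullet> e = (C *v (L *v f)) \<bullet> x"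
        by (simp add: e_def inner_mult_transpose_right flip: L)
      moreover have "e \<bullet> e = (C *v (L *v e)) \<bullet> x"
        by (simp add: e_def inner_mult_transpose_right flip: L)
      moreover have "(C *v (L *v f)) \<bullet> x = (C *v (L *v e)) \<bullet> x + (Rs *v x) \<bullet> x + y \<bullet> x"
        using y by (simp add: x_def[symmetric] e_def[symmetric] inner_add_left)
      moreover have Rx: "matrix_inv Rs *v (Rs *v x) = x"
        using matrix_inv_mult_left[OF posdef_invertible[OF Rs]]
        by (simp add: matrix_vector_mul_assoc)
      moreover have "(Rs *v x) \<bullet> (matrix_inv Rs *v w) = x \<bullet> w"
        using psd_symD[OF Ri, of "Rs *v x" w] by (simp add: Rx)
      moreover have "y \<bullet> (S *v z) = x \<bullet> z"
        using psd_symD[OF S, of y z] by (simp add: x_def)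
      ultimately show ?thesis
        unfolding post x_def[symmetric]
        by (simp add: x_def[symmetric] matrix_vector_right_distrib inner_add_left inner_add_right
            inner_diff_left inner_diff_right
            inner_commute[of e f]
            inner_commute[of v f] inner_commute[of v e] inner_commute[of w x] inner_commute[of z x] algebra_simps)
    qed
    also have "\<dots> \<ge> 0"
      using Ri S by (intro add_nonneg_nonneg) (simp_all only: psd_def inner_ge_zero)
    finally show "0 \<le> \<xi> \<bullet> (?M *v \<xi>)" .
  qed
  \<comment> \<open>\<open>Q\<close> is a diagonal block of the semidefinite matrix and inherits its
    sign.\<close>
  have "0 \<le> u \<bullet> (Q *v u)" for u
  proof -
    have "0 \<le> (u @@@ 0 @@@ 0 @@@ 0) \<bullet> (?M *v (u @@@ 0 @@@ 0 @@@ 0))"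
      using M by (simp only: psd_def)
    then show ?thesis unfolding inner_utility_lmi[OF symL[unfolded L_def]] by simp
  qed
  then have "psd Q" using symQ by (intro psdI)
  then have "feasible P C Rs Mu \<gamma> (S, Q, K)"
    using M S tr[folded Q_def] by (simp add: feasible_def)
  then show ?thesis by blast
qed

theorem theorem2:
  fixes P :: "real^'n^'n" and C :: "real^'n^'m" and Rs :: "real^'m^'m"
    and Mu :: "real^'n^'r" and \<gamma> :: real
    and S :: "real^'m^'m" and Q :: "real^'r^'r" and K :: "real^'m^'n"
  assumes "psd P"
    and "\<And>i j. i \<noteq> j \<Longrightarrow> Rs $ i $ j = 0"
    and "\<And>i. 0 < Rs $ i $ i"
    and "is_arg_min (\<lambda>(S, Q, K). trace S) (feasible P C Rs Mu \<gamma>) (S, Q, K)"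
  shows "trace (posterior_cov_of_precision P C Rs Mu S) \<le> \<gamma> \<and>
    (\<forall>S'. psd S' \<and> trace (posterior_cov_of_precision P C Rs Mu S') \<le> \<gamma> \<longrightarrow>
       trace S \<le> trace S')"
proof (intro conjI allI impI)
  have Rs: "posdef Rs" using assms(2,3) by (rule posdef_diagonal)
  show "trace (posterior_cov_of_precision P C Rs Mu S) \<le> \<gamma>"
    using assms(1,4) Rs by (auto simp: is_arg_min_def intro: feasible_imp_trace_posterior_le)
  fix S' assume "psd S' \<and> trace (posterior_cov_of_precision P C Rs Mu S') \<le> \<gamma>"
  \<comment> \<open>Every admissible precision extends to a feasible triple with the same objective
    value, so it competes with the minimiser.\<close>
  then obtain Q' K' where "feasible P C Rs Mu \<gamma> (S', Q', K')"
    using trace_posterior_le_imp_feasible[OF assms(1) Rs] by blast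
  then show "trace S \<le> trace S'"
    using assms(4) by (force simp: is_arg_min_def not_less)
qed

end
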